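(* Let $G$ be a graph of order $n\geq 2$ and maximum degree $\Delta\ge 0$. For every $t\geq 2$, $$2^{t-1}\max(n+2,\,2(\Delta+2))-2\leq \lambda(M^t(G))\leq (2^t-1)(n+1)+\lambda(G).$$
   Context: Graphs are finite, simple, undirected. An $L(2,1)$-labeling of $G$ is a map $f:V\to\{0,1,2,\dots\}$ with $|f(x)-f(y)|\ge 2$ if $d_G(x,y)=1$ and $|f(x)-f(y)|\ge1$ if $d_G(x,y)=2$; $\lambda(G)$ is the minimum over such $f$ of the largest label. For $V=\{v_1,\dots,v_n\}$, the Mycielski graph $M(G)$ has vertex set $V\cup\{v_1',\dots,v_n'\}\cup\{u\}$ and edge set $E\cup\{v_iv_j' : v_iv_j\in E\}\cup\{v_i'u: 1\le i\le n\}$. The iterated Mycielski graphs are $M^0(G)=G$ and $M^t(G)=M(M^{t-1}(G))$ for $t\ge 1$. *)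

theory Defs
  imports "Graph_Theory.Graph_Theory"
begin

text \<open>
  A finite simple undirected graph is a \<^locale>\<open>pair_graph\<close>: a finite, loop-free digraph with
  symmetric arc set, each edge being the two arcs \<open>(x, y)\<close> and \<open>(y, x)\<close>.
\<close>

text \<open>\<open>\<infinity>\<close> if \<open>x\<close> and \<open>y\<close> lie in different components.\<close>

definition graph_dist :: "'a pair_pre_digraph \<Rightarrow> 'a \<Rightarrow> 'a \<Rightarrow> ereal" where
  "graph_dist G x y = wf_digraph.\<mu> (with_proj G) (\<lambda>_. 1) x y"

text \<open>By symmetry of the arcs, the out-degree of a vertex is its number of neighbours.\<close>

definition max_degree :: "'a pair_pre_digraph \<Rightarrow> nat" where
  "max_degree G = Max (out_degree (with_proj G) ` pverts G)"

definition L21_labeling :: "'a pair_pre_digraph \<Rightarrow> ('a \<Rightarrow> nat) \<Rightarrow> bool" where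
  "L21_labeling G f \<longleftrightarrow>
    (\<forall>x\<in>pverts G. \<forall>y\<in>pverts G.
      (graph_dist G x y = 1 \<longrightarrow> \<bar>int (f x) - int (f y)\<bar> \<ge> 2) \<and>
      (graph_dist G x y = 2 \<longrightarrow> \<bar>int (f x) - int (f y)\<bar> \<ge> 1))"

definition lambda_number :: "'a pair_pre_digraph \<Rightarrow> nat" where
  "lambda_number G = (LEAST k. \<exists>f. L21_labeling G f \<and> k = Max (f ` pverts G))"

text \<open>
  One vertex type closed under the Mycielski construction, so that the construction can be
  iterated: \<open>Orig v\<close> is \<open>v\<close> itself regarded as a vertex of the new graph, \<open>Copy v\<close> is \<open>v'\<close>,
  \<open>Root\<close> is \<open>u\<close>, and \<open>Base\<close> injects the vertices of the initial graph.
\<close>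

datatype 'a mvert = Base 'a | Orig "'a mvert" | Copy "'a mvert" | Root

definition mycielski :: "'a mvert pair_pre_digraph \<Rightarrow> 'a mvert pair_pre_digraph" where
  "mycielski G =
    \<lparr> pverts = Orig ` pverts G \<union> Copy ` pverts G \<union> {Root},
      parcs = {(Orig x, Orig y) | x y. (x, y) \<in> parcs G}
        \<union> {(Orig x, Copy y) | x y. (x, y) \<in> parcs G}
        \<union> {(Copy y, Orig x) | x y. (x, y) \<in> parcs G}
        \<union> {(Copy x, Root) | x. x \<in> pverts G}
        \<union> {(Root, Copy x) | x. x \<in> pverts G} \<rparr>"

definition base_graph :: "'a pair_pre_digraph \<Rightarrow> 'a mvert pair_pre_digraph" where
  "base_graph G = \<lparr> pverts = Base ` pverts G, parcs = map_prod Base Base ` parcs G \<rparr>"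

definition iterated_mycielski :: "nat \<Rightarrow> 'a pair_pre_digraph \<Rightarrow> 'a mvert pair_pre_digraph" where
  "iterated_mycielski t G = (mycielski ^^ t) (base_graph G)"

lemma pair_graph_base_graph:
  assumes "pair_graph G"
  shows "pair_graph (base_graph G)"
proof -
  interpret pair_graph G by fact
  show ?thesis
    by unfold_locales
      (auto simp: base_graph_def symmetric_def sym_def
        dest: in_arcsD1 in_arcsD2 no_loops' arcs_symmetric)
qed

lemma pair_graph_mycielski:
  assumes "pair_graph G"
  shows "pair_graph (mycielski G)"
proof -
  interpret pair_graph G by fact
  have fin: "finite (parcs (mycielski G))"
  proof (rule finite_subset)
    show "parcs (mycielski G) \<subseteq> pverts (mycielski G) \<times> pverts (mycielski G)"
      by (auto simp: mycielski_def dest: in_arcsD1 in_arcsD2)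
    show "finite (pverts (mycielski G) \<times> pverts (mycielski G))"
      by (auto simp: mycielski_def)
  qed
  show ?thesis
    by unfold_locales
      (use fin in \<open>auto simp: mycielski_def symmetric_def sym_def
        dest: in_arcsD1 in_arcsD2 no_loops' arcs_symmetric\<close>)
qed

lemma pair_graph_iterated_mycielski:
  assumes "pair_graph G"
  shows "pair_graph (iterated_mycielski t G)"
  unfolding iterated_mycielski_def
  by (induction t) (simp_all add: assms pair_graph_base_graph pair_graph_mycielski)

end

theory Submission
  imports Defs
begin

text \<open>
  Upper bound: from an optimal labeling \<open>f\<close> of a graph with \<open>m\<close> vertices, label the root of the
  Mycielski graph by 0, the original vertices by \<open>f + 1\<close> and the copies bijectively by
  \<open>\<lambda> + 2, \<dots>, \<lambda> + m + 1\<close>, where the label \<open>\<lambda> + 2\<close> goes to the copy of a vertex with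
  \<open>f\<close>-label \<open>\<lambda>\<close>, whose neighbours all have \<open>f\<close>-label at most \<open>\<lambda> - 2\<close>. So each Mycielski step
  raises \<open>\<lambda>\<close> by at most \<open>m + 1\<close>, a quantity that doubles in every step.

  Lower bound: a set of \<open>s\<close> non-isolated vertices at pairwise distance at most two forces
  \<open>\<lambda> \<ge> s - 1\<close>. In the Mycielski graph the originals and copies of such a set together with the
  root form such a set again, of size \<open>2 s + 1\<close>, so that \<open>s + 1\<close> doubles. Start with a closed
  neighbourhood of a vertex of maximum degree in \<open>G\<close>, or with the copies and the root
  in \<open>M(G)\<close>.
\<close>

section \<open>Labelings\<close>

text \<open>Walk lengths are natural numbers, so an infimum with a finite value \<open>k\<close> is
  attained: otherwise every walk would have length at least \<open>k + 1\<close>, and so would the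
  infimum.\<close>

lemma graph_dist_eq_nat_iff:
  assumes "pair_wf_digraph G"
  shows "graph_dist G x y = ereal (real k) \<longleftrightarrow>
    (\<exists>p. pre_digraph.awalk (with_proj G) x p y \<and> length p = k) \<and>
    (\<forall>p. pre_digraph.awalk (with_proj G) x p y \<longrightarrow> k \<le> length p)"
    (is "?L \<longleftrightarrow> ?R")
proof -
  interpret pair_wf_digraph G by fact
  have cost: "awalk_cost (\<lambda>_. 1) p = real (length p)" for p :: "('a \<times> 'a) list"
    by (induction p) auto
  have dist: "graph_dist G x y = (INF p\<in>{p. awalk x p y}. ereal (real (length p)))"
    by (simp add: graph_dist_def \<mu>_def cost)
  show ?thesis
  proof
    assume L: ?L
    have lower: "k \<le> length p" if "awalk x p y" for p
    proof -
      have "ereal (real k) \<le> ereal (real (length p))"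
        using that L unfolding dist by (metis INF_lower mem_Collect_eq)
      then show ?thesis by simp
    qed
    have "\<exists>p. awalk x p y \<and> length p = k"
    proof (rule ccontr)
      assume "\<not> ?thesis"
      then have "Suc k \<le> length p" if "awalk x p y" for p
        using lower[OF that] that by (metis Suc_leI le_neq_implies_less)
      then have "ereal (real (Suc k)) \<le> graph_dist G x y"
        unfolding dist by (intro INF_greatest) (metis ereal_less_eq(3) mem_Collect_eq of_nat_le_iff)
      with L show False by simp
    qed
    with lower show ?R by blast
  next
    assume ?R
    then obtain p where p: "awalk x p y" "length p = k"
      and lower: "\<And>q. awalk x q y \<Longrightarrow> k \<le> length q" by blast
    show ?L
      unfolding dist
    proof (rule antisym)
      show "(INF p\<in>{p. awalk x p y}. ereal (real (length p))) \<le> ereal (real k)"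
        using p by (intro INF_lower2[of p]) auto
      show "ereal (real k) \<le> (INF p\<in>{p. awalk x p y}. ereal (real (length p)))"
        using lower by (intro INF_greatest) auto
    qed
  qed
qed

text \<open>Removes distances in favour of arcs. The second condition may ignore whether
  \<open>x\<close> and \<open>y\<close> are adjacent, because adjacent vertices have different
  labels by the first one.\<close>

lemma L21_labeling_iff:
  assumes "pair_graph G"
  shows "L21_labeling G f \<longleftrightarrow>
    (\<forall>x y. (x, y) \<in> parcs G \<longrightarrow> \<bar>int (f x) - int (f y)\<bar> \<ge> 2) \<and>
    (\<forall>x y z. (x, z) \<in> parcs G \<longrightarrow> (z, y) \<in> parcs G \<longrightarrow> x \<noteq> y \<longrightarrow> f x \<noteq> f y)"
proof -
  interpret pair_graph G by fact
  have len1: "(\<exists>p. awalk x p y \<and> length p = 1) \<longleftrightarrow> (x, y) \<in> parcs G" for x y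
  proof
    assume "\<exists>p. awalk x p y \<and> length p = 1"
    then obtain e where "awalk x [e] y" by (auto simp: length_Suc_conv)
    then show "(x, y) \<in> parcs G" by (cases e) (simp add: awalk_Cons_iff awalk_Nil_iff)
  next
    assume "(x, y) \<in> parcs G"
    then have "awalk x [(x, y)] y"
      using in_arcsD2 by (simp add: awalk_Cons_iff awalk_Nil_iff)
    then show "\<exists>p. awalk x p y \<and> length p = 1"
      by (intro exI[of _ "[(x, y)]"]) simp
  qed
  have len2: "(\<exists>p. awalk x p y \<and> length p = 2) \<longleftrightarrow>
      (\<exists>z. (x, z) \<in> parcs G \<and> (z, y) \<in> parcs G)" for x y
  proof
    assume "\<exists>p. awalk x p y \<and> length p = 2"
    then obtain e e' where "awalk x [e, e'] y" by (auto simp: length_Suc_conv numeral_2_eq_2)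
    then have "(x, snd e) \<in> parcs G \<and> (snd e, y) \<in> parcs G"
      by (cases e, cases e') (simp add: awalk_Cons_iff awalk_Nil_iff)
    then show "\<exists>z. (x, z) \<in> parcs G \<and> (z, y) \<in> parcs G" by blast
  next
    assume "\<exists>z. (x, z) \<in> parcs G \<and> (z, y) \<in> parcs G"
    then obtain z where "(x, z) \<in> parcs G" "(z, y) \<in> parcs G" by blast
    then have "awalk x [(x, z), (z, y)] y"
      using in_arcsD2 by (simp add: awalk_Cons_iff awalk_Nil_iff)
    then show "\<exists>p. awalk x p y \<and> length p = 2"
      by (intro exI[of _ "[(x, z), (z, y)]"]) simp
  qed
  have len0: "(\<exists>p. awalk x p y \<and> length p = 0) \<longleftrightarrow> x = y \<and> x \<in> pverts G" for x y
    by (auto simp: awalk_Nil_iff)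
  have lower1: "(\<forall>p. awalk x p y \<longrightarrow> 1 \<le> length p) \<longleftrightarrow> \<not> (\<exists>p. awalk x p y \<and> length p = 0)"
    for x y by (force simp: Suc_le_eq)
  have lower2: "(\<forall>p. awalk x p y \<longrightarrow> 2 \<le> length p) \<longleftrightarrow>
      \<not> (\<exists>p. awalk x p y \<and> length p = 0) \<and> \<not> (\<exists>p. awalk x p y \<and> length p = 1)" for x y
  proof -
    have "2 \<le> k \<longleftrightarrow> k \<noteq> 0 \<and> k \<noteq> 1" for k :: nat by linarith
    then show ?thesis by metis
  qed
  have wf: "pair_wf_digraph G" by unfold_locales
  have dist1: "graph_dist G x y = 1 \<longleftrightarrow> (x, y) \<in> parcs G" for x y
    using graph_dist_eq_nat_iff[OF wf, of x y 1] no_loops'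
    unfolding len1 lower1 len0 by (auto simp: one_ereal_def)
  have dist2: "graph_dist G x y = 2 \<longleftrightarrow>
      x \<noteq> y \<and> (x, y) \<notin> parcs G \<and> (\<exists>z. (x, z) \<in> parcs G \<and> (z, y) \<in> parcs G)" for x y
    using graph_dist_eq_nat_iff[OF wf, of x y 2]
    unfolding len2 lower2 len0 len1 by (auto dest: in_arcsD1)
  show ?thesis
    unfolding L21_labeling_def dist1 dist2
  proof (intro iffI conjI allI impI ballI; (elim conjE exE)?)
    fix x y z
    assume L: "\<forall>x\<in>pverts G. \<forall>y\<in>pverts G.
        ((x, y) \<in> parcs G \<longrightarrow> 2 \<le> \<bar>int (f x) - int (f y)\<bar>) \<and>
        (x \<noteq> y \<and> (x, y) \<notin> parcs G \<and> (\<exists>z. (x, z) \<in> parcs G \<and> (z, y) \<in> parcs G) \<longrightarrow>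
          1 \<le> \<bar>int (f x) - int (f y)\<bar>)"
      and *: "(x, z) \<in> parcs G" "(z, y) \<in> parcs G" "x \<noteq> y"
    then show "f x \<noteq> f y"
      using in_arcsD1[OF *(1)] in_arcsD2[OF *(2)] by (cases "(x, y) \<in> parcs G") force+
  next
    fix x y z
    assume "\<forall>x y z. (x, z) \<in> parcs G \<longrightarrow> (z, y) \<in> parcs G \<longrightarrow> x \<noteq> y \<longrightarrow> f x \<noteq> f y"
      and "(x, z) \<in> parcs G" "(z, y) \<in> parcs G" "x \<noteq> y"
    then have "f x \<noteq> f y" by blast
    then show "1 \<le> \<bar>int (f x) - int (f y)\<bar>" by linarith
  qed (blast dest: in_arcsD1 in_arcsD2)+
qed

text \<open>Doubling an injective numbering separates all distinct vertices by at least 2. This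
  makes the \<open>LEAST\<close> in \<open>lambda_number\<close> range over a nonempty set.\<close>

lemma L21_labeling_exists:
  assumes "pair_graph G"
  shows "\<exists>f. L21_labeling G f"
proof -
  interpret pair_graph G by fact
  obtain h :: "'a \<Rightarrow> nat" where h: "inj_on h (pverts G)"
    using ex_bij_betw_finite_nat[of "pverts G"] by (auto simp: bij_betw_def)
  have neq: "h x \<noteq> h y" if "x \<in> pverts G" "y \<in> pverts G" "x \<noteq> y" for x y
    using that h by (auto dest: inj_onD)
  have "L21_labeling G (\<lambda>x. 2 * h x)"
    unfolding L21_labeling_iff[OF assms]
  proof (intro conjI allI impI)
    fix x y assume "(x, y) \<in> parcs G"
    then have "h x \<noteq> h y"
      by (metis neq in_arcsD1 in_arcsD2 no_loops')
    then show "2 \<le> \<bar>int (2 * h x) - int (2 * h y)\<bar>" by linarith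
  qed (use neq in \<open>auto dest: in_arcsD1 in_arcsD2\<close>)
  then show ?thesis by blast
qed

lemma lambda_number_le:
  "L21_labeling G f \<Longrightarrow> lambda_number G \<le> Max (f ` pverts G)"
  unfolding lambda_number_def by (rule Least_le) blast

lemma lambda_number_attained:
  assumes "pair_graph G"
  obtains f where "L21_labeling G f" "lambda_number G = Max (f ` pverts G)"
  using LeastI_ex[of "\<lambda>k. \<exists>f. L21_labeling G f \<and> k = Max (f ` pverts G)"]
    L21_labeling_exists[OF assms] that
  unfolding lambda_number_def by blast

section \<open>The upper bound\<close>

lemma lambda_number_base_graph_le:
  assumes "pair_graph G"
  shows "lambda_number (base_graph G) \<le> lambda_number G"
proof -
  obtain f where f: "L21_labeling G f" "lambda_number G = Max (f ` pverts G)"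
    using lambda_number_attained[OF assms] .
  define F where "F v = (case v of Base a \<Rightarrow> f a | _ \<Rightarrow> 0)" for v
  have "L21_labeling (base_graph G) F"
    using f(1) unfolding L21_labeling_iff[OF assms]
      L21_labeling_iff[OF pair_graph_base_graph[OF assms]]
    by (auto simp: base_graph_def F_def)
  moreover have "F ` pverts (base_graph G) = f ` pverts G"
    by (auto simp: base_graph_def F_def image_image)
  ultimately show ?thesis
    using lambda_number_le f(2) by metis
qed

lemma lambda_number_mycielski_le:
  assumes "pair_graph G" and "pverts G \<noteq> {}"
  shows "lambda_number (mycielski G) \<le> lambda_number G + card (pverts G) + 1"
proof -
  interpret pair_graph G by fact
  define l where "l = lambda_number G"
  define n where "n = card (pverts G)"
  obtain f where f: "L21_labeling G f" "l = Max (f ` pverts G)"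
    using lambda_number_attained[OF assms(1)] unfolding l_def .
  have f_le: "f x \<le> l" if "x \<in> pverts G" for x
    using that f(2) by simp
  obtain v where v: "v \<in> pverts G" "f v = l"
  proof -
    have "l \<in> f ` pverts G" unfolding f(2) using assms(2) by (intro Max_in) auto
    then show ?thesis using that by blast
  qed
  obtain h where h: "inj_on h (pverts G - {v})" "h ` (pverts G - {v}) = {i. i < n - 1}"
    using ex_bij_betw_finite_nat[of "pverts G - {v}"] v(1)
    by (auto simp: bij_betw_def n_def atLeast0LessThan lessThan_def)
  \<comment> \<open>\<open>g\<close> numbers the vertices by 0, ..., n - 1 and puts
    \<open>v\<close>, a vertex of maximal label, first.\<close>
  define g where "g x = (if x = v then 0 else Suc (h x))" for x
  have g_inj: "g x \<noteq> g y" if "x \<in> pverts G" "y \<in> pverts G" "x \<noteq> y" for x y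
    using that h(1) by (auto simp: g_def dest: inj_onD)
  have g_less: "g x < n" if "x \<in> pverts G" for x
  proof (cases "x = v")
    case True
    then show ?thesis using v(1) by (auto simp: g_def n_def card_gt_0_iff)
  next
    case False
    then have "h x < n - 1" using h(2) that by blast
    then show ?thesis using False by (simp add: g_def)
  qed
  have f_arc: "\<bar>int (f x) - int (f y)\<bar> \<ge> 2" if "(x, y) \<in> parcs G" for x y
    using f(1) that unfolding L21_labeling_iff[OF assms(1)] by blast
  have f_two: "f x \<noteq> f y" if "(x, z) \<in> parcs G" "(z, y) \<in> parcs G" "x \<noteq> y" for x y z
    using f(1) that unfolding L21_labeling_iff[OF assms(1)] by blast
  \<comment> \<open>This is the gap of 2 between the future labels \<open>f x + 1\<close> of
    \<open>Orig x\<close> and \<open>l + 2 + g y\<close> of \<open>Copy y\<close>. If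
    \<open>y = v\<close>, then \<open>f x\<close> is at most \<open>l - 2\<close>; otherwise
    \<open>g y\<close> is at least 1.\<close>
  have f_g: "f x + 1 \<le> l + g y" if "(x, y) \<in> parcs G" for x y
  proof (cases "y = v")
    case True
    then show ?thesis using f_arc[OF that] f_le[OF in_arcsD1[OF that]] v(2) by simp
  next
    case False
    then show ?thesis using f_le[OF in_arcsD1[OF that]] by (simp add: g_def)
  qed
  \<comment> \<open>The labels fall into three disjoint ranges: 0, then 1 to \<open>l + 1\<close>,
    then \<open>l + 2\<close> to \<open>l + n + 1\<close>. Only vertices of the same kind can
    collide. \<open>Base\<close> vertices do not occur in \<open>mycielski G\<close>, so their value
    is arbitrary.\<close>
  define F where
    "F w = (case w of Base _ \<Rightarrow> 0 | Orig x \<Rightarrow> f x + 1 | Copy x \<Rightarrow> l + 2 + g x | Root \<Rightarrow> 0)" for w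
  have F: "F (Orig x) = f x + 1" "F (Copy x) = l + 2 + g x" "F Root = 0" for x
    by (auto simp: F_def)
  \<comment> \<open>These cover two originals joined through a copy and two copies joined through an
    original, with the arcs oriented as \<open>mycielski\<close> lists them.\<close>
  have f_copies: "x = y" if "f x = f y" "(x, z) \<in> parcs G" "(y, z) \<in> parcs G" for x y z
    using f_two arcs_symmetric that by blast
  have g_copies: "x = y" if "g x = g y" "(z, x) \<in> parcs G" "(z, y) \<in> parcs G" for x y z
    using g_inj in_arcsD2 that by blast
  have "L21_labeling (mycielski G) F"
    unfolding L21_labeling_iff[OF pair_graph_mycielski[OF assms(1)]]
  proof (intro conjI allI impI)
    fix a b assume "(a, b) \<in> parcs (mycielski G)"
    then show "2 \<le> \<bar>int (F a) - int (F b)\<bar>"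
      by (auto simp: mycielski_def F dest: f_arc f_g)
  next
    fix a b c
    assume "(a, c) \<in> parcs (mycielski G)" "(c, b) \<in> parcs (mycielski G)" "a \<noteq> b"
    then show "F a \<noteq> F b"
      by (auto simp: mycielski_def F 
        dest: f_two f_copies g_copies g_inj f_le[OF in_arcsD1] f_le[OF in_arcsD2])
  qed
  then have "lambda_number (mycielski G) \<le> Max (F ` pverts (mycielski G))"
    by (rule lambda_number_le)
  also have "\<dots> \<le> l + n + 1"
  proof (rule Max.boundedI)
    fix k assume "k \<in> F ` pverts (mycielski G)"
    then show "k \<le> l + n + 1"
      by (auto simp: mycielski_def F dest: f_le g_less)
  qed (auto simp: mycielski_def)
  finally show ?thesis by (simp add: l_def n_def)
qed

lemma card_pverts_mycielski:
  assumes "finite (pverts G)"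
  shows "card (pverts (mycielski G)) = 2 * card (pverts G) + 1"
proof -
  have "card (Orig ` pverts G \<union> Copy ` pverts G) = 2 * card (pverts G)"
    using assms by (subst card_Un_disjoint) (auto simp: card_image inj_on_def)
  moreover have "Root \<notin> Orig ` pverts G \<union> Copy ` pverts G" by auto
  ultimately show ?thesis
    using assms by (simp add: mycielski_def)
qed

lemma iterated_mycielski_0: "iterated_mycielski 0 G = base_graph G"
  by (simp add: iterated_mycielski_def)

lemma iterated_mycielski_Suc:
  "iterated_mycielski (Suc t) G = mycielski (iterated_mycielski t G)"
  by (simp add: iterated_mycielski_def)

lemma card_pverts_iterated_mycielski:
  assumes "pair_graph G"
  shows "card (pverts (iterated_mycielski t G)) + 1 = 2 ^ t * (card (pverts G) + 1)"
proof (induction t)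
  case 0
  show ?case
    by (simp add: iterated_mycielski_0 base_graph_def card_image inj_on_def)
next
  case (Suc t)
  interpret M: pair_graph "iterated_mycielski t G"
    by (rule pair_graph_iterated_mycielski[OF assms])
  show ?case
    using Suc by (simp add: iterated_mycielski_Suc card_pverts_mycielski)
qed

text \<open>Step \<open>i\<close> adds 2^i (n + 1), and these increments for i < t form a geometric
  sum.\<close>

lemma lambda_number_iterated_mycielski_le:
  assumes "pair_graph G" and "pverts G \<noteq> {}"
  shows "int (lambda_number (iterated_mycielski t G))
    \<le> (2 ^ t - 1) * (int (card (pverts G)) + 1) + int (lambda_number G)"
proof (induction t)
  case 0
  show ?case
    using lambda_number_base_graph_le[OF assms(1)] by (simp add: iterated_mycielski_0)
next
  case (Suc t)
  let ?M = "iterated_mycielski t G"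
  have "pverts ?M \<noteq> {}"
    using assms(2) by (cases t)
      (auto simp: iterated_mycielski_0 iterated_mycielski_Suc base_graph_def mycielski_def)
  then have "lambda_number (mycielski ?M) \<le> lambda_number ?M + (card (pverts ?M) + 1)"
    using lambda_number_mycielski_le[OF pair_graph_iterated_mycielski[OF assms(1)]] by simp
  also have "\<dots> = lambda_number ?M + 2 ^ t * (card (pverts G) + 1)"
    using card_pverts_iterated_mycielski[OF assms(1)] by metis
  finally have "int (lambda_number (mycielski ?M))
      \<le> int (lambda_number ?M + 2 ^ t * (card (pverts G) + 1))"
    by (rule of_nat_mono)
  with Suc show ?case
    by (simp add: iterated_mycielski_Suc algebra_simps)
qed

section \<open>The lower bound\<close>

text \<open>
  For \<open>x = y\<close> the condition says, in a loop-free symmetric graph, that \<open>x\<close> is not isolated.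
\<close>

definition two_clique :: "'a pair_pre_digraph \<Rightarrow> 'a set \<Rightarrow> bool" where
  "two_clique G S \<longleftrightarrow> S \<subseteq> pverts G \<and>
    (\<forall>x\<in>S. \<forall>y\<in>S. (x, y) \<in> parcs G \<or> (\<exists>z. (x, z) \<in> parcs G \<and> (z, y) \<in> parcs G))"

text \<open>A labeling is injective on \<open>S\<close>, and only \<open>lambda_number G + 1\<close>
  labels are available to an optimal one.\<close>

lemma card_two_clique_le:
  assumes "pair_graph G" and "two_clique G S"
  shows "card S \<le> lambda_number G + 1"
proof -
  interpret pair_graph G by fact
  obtain f where f: "L21_labeling G f" "lambda_number G = Max (f ` pverts G)"
    using lambda_number_attained[OF assms(1)] .
  have "f x \<noteq> f y" if "x \<in> S" "y \<in> S" "x \<noteq> y" for x y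
    using f(1) assms(2) that unfolding L21_labeling_iff[OF assms(1)] two_clique_def
    by (metis abs_zero diff_self not_numeral_le_zero)
  then have "inj_on f S" by (meson inj_onI)
  moreover have "f ` S \<subseteq> {..lambda_number G}"
    using assms(2) f(2) by (auto simp: two_clique_def)
  ultimately have "card S \<le> card {..lambda_number G}"
    by (intro card_inj_on_le) auto
  then show ?thesis by simp
qed

text \<open>A walk of length one or two between members of \<open>S\<close> lifts with either one of
  its ends replaced by its copy. Two copies meet at \<open>Root\<close>, and an original reaches
  \<open>Root\<close> through the copy of a neighbour.\<close>

lemma two_clique_mycielski:
  assumes "pair_graph G" and "pverts G \<noteq> {}" and "two_clique G S"
  shows "two_clique (mycielski G) (Orig ` S \<union> Copy ` S \<union> {Root})"
proof -
  interpret pair_graph G by fact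
  have sub: "S \<subseteq> pverts G" using assms(3) by (simp add: two_clique_def)
  \<comment> \<open>The case \<open>x = y\<close> of \<open>two_clique\<close>: there are no loops,
    so \<open>x\<close> lies on a walk to a neighbour and back.\<close>
  have nb: "\<exists>z. (x, z) \<in> parcs G \<and> (z, x) \<in> parcs G \<and> z \<in> pverts G" if "x \<in> S" for x
    using assms(3) that no_loops' arcs_symmetric in_arcsD2 unfolding two_clique_def by metis
  have two: "(x, y) \<in> parcs G \<or> (\<exists>z. (x, z) \<in> parcs G \<and> (z, y) \<in> parcs G)"
    if "x \<in> S" "y \<in> S" for x y
    using assms(3) that by (simp add: two_clique_def)
  let ?M = "mycielski G"
  have OO: "(Orig x, Orig y) \<in> parcs ?M" and OC: "(Orig x, Copy y) \<in> parcs ?M"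
    and CO: "(Copy x, Orig y) \<in> parcs ?M" if "(x, y) \<in> parcs G" for x y
    using that arcs_symmetric[OF that] by (auto simp: mycielski_def)
  have CR: "(Copy x, Root) \<in> parcs ?M" "(Root, Copy x) \<in> parcs ?M" if "x \<in> pverts G" for x
    using that by (auto simp: mycielski_def)
  define near where
    "near a b \<longleftrightarrow> (a, b) \<in> parcs ?M \<or> (\<exists>c. (a, c) \<in> parcs ?M \<and> (c, b) \<in> parcs ?M)" for a b
  have "near (Orig x) (Orig y)" "near (Orig x) (Copy y)" "near (Copy x) (Orig y)"
    if "x \<in> S" "y \<in> S" for x y
    using two[OF that] OO OC CO unfolding near_def by blast+
  moreover have "near (Copy x) (Copy y)" if "x \<in> S" "y \<in> S" for x y
    using CR that sub unfolding near_def by blast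
  moreover have "near (Orig x) Root" "near Root (Orig x)" if "x \<in> S" for x
    using nb[OF that] OC CO CR unfolding near_def by blast+
  moreover have "near (Copy x) Root" "near Root (Copy x)" if "x \<in> S" for x
    using that sub CR unfolding near_def by blast+
  moreover have "near Root Root"
    using assms(2) CR unfolding near_def by blast
  ultimately have
    "\<forall>a \<in> Orig ` S \<union> Copy ` S \<union> {Root}. \<forall>b \<in> Orig ` S \<union> Copy ` S \<union> {Root}. near a b"
    by blast
  moreover have "Orig ` S \<union> Copy ` S \<union> {Root} \<subseteq> pverts ?M"
    using sub by (auto simp: mycielski_def)
  ultimately show ?thesis
    unfolding two_clique_def near_def by blast
qed

text \<open>The copies are joined through \<open>Root\<close> whatever the arcs of \<open>G\<close>
  are, so this starting set is available even for an edgeless graph.\<close>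

lemma two_clique_copies_Root:
  assumes "pverts G \<noteq> {}"
  shows "two_clique (mycielski G) (Copy ` pverts G \<union> {Root})"
  using assms by (auto simp: two_clique_def mycielski_def)

lemma two_clique_base_graph:
  "two_clique G S \<Longrightarrow> two_clique (base_graph G) (Base ` S)"
  by (force simp: two_clique_def base_graph_def)

text \<open>Neighbours are joined through \<open>v\<close>, and \<open>v\<close> returns to itself
  through \<open>w\<close>.\<close>

lemma two_clique_closed_neighbourhood:
  assumes "pair_graph G" and "(v, w) \<in> parcs G"
  shows "two_clique G (insert v {x. (v, x) \<in> parcs G})"
proof -
  interpret pair_graph G by fact
  show ?thesis
    using assms(2) arcs_symmetric in_arcsD1 in_arcsD2 unfolding two_clique_def by blast
qed

text \<open>The induction peels off the innermost construction, hence \<open>H\<close> and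
  \<open>S\<close> are arbitrary. The 2 on the right is 1 from \<open>card_two_clique_le\<close>
  plus the 1 that makes the size double exactly.\<close>

lemma lambda_number_funpow_mycielski_ge:
  assumes "pair_graph H" and "pverts H \<noteq> {}" and "two_clique H S"
  shows "2 ^ t * (card S + 1) \<le> lambda_number ((mycielski ^^ t) H) + 2"
  using assms
proof (induction t arbitrary: H S)
  case 0
  then show ?case using card_two_clique_le by force
next
  case (Suc t)
  interpret pair_graph H by fact
  let ?S = "Orig ` S \<union> Copy ` S \<union> {Root}"
  have "finite S"
    using Suc.prems(3) finite_subset[of S "pverts H"] by (simp add: two_clique_def)
  then have "card (Orig ` S \<union> Copy ` S) = 2 * card S"
    by (subst card_Un_disjoint) (auto simp: card_image inj_on_def)
  moreover have "Root \<notin> Orig ` S \<union> Copy ` S" by auto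
  ultimately have "card ?S + 1 = 2 * (card S + 1)"
    using \<open>finite S\<close> by simp
  moreover have "2 ^ t * (card ?S + 1) \<le> lambda_number ((mycielski ^^ t) (mycielski H)) + 2"
    by (rule Suc.IH[OF pair_graph_mycielski[OF Suc.prems(1)] _ two_clique_mycielski[OF Suc.prems]])
      (simp add: mycielski_def)
  ultimately show ?case
    by (simp add: funpow_swap1 algebra_simps)
qed

theorem theorem4p1:
  fixes G :: "'a pair_pre_digraph" and n \<Delta> t :: nat
  assumes "pair_graph G"
    and "card (pverts G) = n" and "n \<ge> 2"
    and "max_degree G = \<Delta>"
    and "t \<ge> 2"
  shows "2 ^ (t - 1) * max (int n + 2) (2 * (int \<Delta> + 2)) - 2
           \<le> int (lambda_number (iterated_mycielski t G))
       \<and> int (lambda_number (iterated_mycielski t G))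
           \<le> (2 ^ t - 1) * (int n + 1) + int (lambda_number G)"
proof (rule conjI)
  interpret pair_graph G by fact
  have ne: "pverts G \<noteq> {}" using assms(2,3) by auto
  then show "int (lambda_number (iterated_mycielski t G))
      \<le> (2 ^ t - 1) * (int n + 1) + int (lambda_number G)"
    using lambda_number_iterated_mycielski_le[OF assms(1)] assms(2) by simp
  let ?B = "base_graph G"
  have B: "pair_graph ?B" "pverts ?B \<noteq> {}"
    using pair_graph_base_graph[OF assms(1)] ne by (auto simp: base_graph_def)
  define l where "l = lambda_number (iterated_mycielski t G)"
  obtain s where t: "t = Suc s" using assms(5) by (cases t) auto
  \<comment> \<open>The set of n + 1 copies and root lives in \<open>mycielski ?B\<close>, which
    leaves \<open>s\<close> = t - 1 steps.\<close>
  have order: "2 ^ s * (n + 2) \<le> l + 2"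
  proof -
    have "card (Copy ` pverts ?B \<union> {Root}) = n + 1"
      using assms(2) by (subst Un_commute)
        (auto simp: base_graph_def image_image card_image inj_on_def card_insert_if)
    moreover have "2 ^ s * (card (Copy ` pverts ?B \<union> {Root}) + 1)
        \<le> lambda_number ((mycielski ^^ s) (mycielski ?B)) + 2"
      using B by (intro lambda_number_funpow_mycielski_ge pair_graph_mycielski
          two_clique_copies_Root) (auto simp: mycielski_def)
    ultimately show ?thesis
      by (simp add: l_def t iterated_mycielski_def funpow_swap1)
  qed
  have degree: "2 ^ s * (2 * (\<Delta> + 2)) \<le> l + 2"
  proof (cases "\<Delta> = 0")
    case True
    \<comment> \<open>Without arcs there is no neighbourhood to start from, but then 2 (\<Delta> +
      2) = 4 \<le> n + 2.\<close>
    have "2 ^ s * (2 * (\<Delta> + 2)) \<le> 2 ^ s * (n + 2)"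
      using True assms(3) by simp
    then show ?thesis using order by linarith
  next
    case False
    have "\<Delta> \<in> out_degree (with_proj G) ` pverts G"
      unfolding assms(4)[symmetric] max_degree_def using ne by (intro Max_in) auto
    then obtain v where v: "out_degree (with_proj G) v = \<Delta>" by auto
    let ?N = "{x. (v, x) \<in> parcs G}"
    have "out_arcs (with_proj G) v = Pair v ` ?N"
      by (auto simp: out_arcs_def)
    then have cardN: "card ?N = \<Delta>"
      using v by (simp add: out_degree_def card_image inj_on_def)
    then have "finite ?N" "?N \<noteq> {}" using False card_ge_0_finite[of ?N] by force+
    then obtain w where w: "(v, w) \<in> parcs G" by auto
    have "v \<notin> ?N" using no_loops' by auto
    then have "card (Base ` insert v ?N) = \<Delta> + 1"
      using cardN \<open>finite ?N\<close> by (subst card_image) (auto simp: inj_on_def)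
    \<comment> \<open>This set of \<Delta> + 1 vertices lives in \<open>?B\<close> itself, so all
      \<open>t\<close> steps count; the extra step supplies the factor 2 in front of \<Delta> +
      2.\<close>
    moreover have "2 ^ t * (card (Base ` insert v ?N) + 1) \<le> l + 2"
      unfolding l_def iterated_mycielski_def
      using B two_clique_base_graph[OF two_clique_closed_neighbourhood[OF assms(1) w]]
      by (rule lambda_number_funpow_mycielski_ge)
    ultimately show ?thesis by (simp add: t)
  qed
  have "2 ^ s * max (n + 2) (2 * (\<Delta> + 2)) \<le> l + 2"
    using order degree by (simp add: max_def)
  then have "int (2 ^ s * max (n + 2) (2 * (\<Delta> + 2))) \<le> int (l + 2)"
    by (rule of_nat_mono)
  moreover have "int (max (n + 2) (2 * (\<Delta> + 2))) = max (int n + 2) (2 * (int \<Delta> + 2))"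
    by (simp add: max_def)
  ultimately have "2 ^ s * max (int n + 2) (2 * (int \<Delta> + 2)) \<le> int l + 2"
    by (metis of_nat_add of_nat_mult of_nat_numeral of_nat_power)
  then show "2 ^ (t - 1) * max (int n + 2) (2 * (int \<Delta> + 2)) - 2
      \<le> int (lambda_number (iterated_mycielski t G))"
    unfolding t l_def[symmetric] diff_Suc_1 by (simp only: l_def t diff_le_eq)
qed

end
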